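(* Let $G$ be a (finite) maximal triangle-free graph which does not contain the Mycielski–Grötzsch graph $\Upsilon$ as a subgraph and which satisfies property $\mathscr{D}_3$. Then $G$ is a blow-up of some Andrásfai graph $\Gamma_k$.
   Context: A graph is maximal triangle-free if it contains no triangle but adding any new edge between two non-adjacent vertices creates a triangle. A blow-up of $H$ is any graph obtained by replacing each vertex of $H$ by a non-empty independent set and each edge of $H$ by the complete bipartite graph between the corresponding sets, with no further edges. Property $\mathscr{D}_k$: for every $m\in\{1,\dots,k\}$ and every sequence $x_1,\dots,x_{3m}$ of (not necessarily distinct) vertices there is a vertex $y$ with $|\{i\in[3m]: x_iy\in E(G)\}|\ge m+1$. Andrásfai graph $\Gamma_k$ ($k\ge1$): vertex set $\mathbb Z/(3k-1)\mathbb Z$, $ij$ an edge iff $i-j\in\{k,\dots,2k-1\}$ mod $3k-1$. Mycielski–Grötzsch graph $\Upsilon$: vertices $a_j,b_j$ ($j\in\mathbb Z/5\mathbb Z$) and $c$; its 20 edges are all pairs $a_jc$, $a_jb_{j+2}$, $a_jb_{j-2}$, $b_jb_{j+2}$. *)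

theory Defs
  imports Main
begin

definition graph :: "'a set \<Rightarrow> ('a \<Rightarrow> 'a \<Rightarrow> bool) \<Rightarrow> bool" where
  "graph V E \<longleftrightarrow> finite V \<and> (\<forall>u v. E u v \<longrightarrow> u \<in> V \<and> v \<in> V)
     \<and> (\<forall>u v. E u v \<longrightarrow> E v u) \<and> (\<forall>u. \<not> E u u)"

definition triangle_free :: "'a set \<Rightarrow> ('a \<Rightarrow> 'a \<Rightarrow> bool) \<Rightarrow> bool" where
  "triangle_free V E \<longleftrightarrow> \<not> (\<exists>x\<in>V. \<exists>y\<in>V. \<exists>z\<in>V. E x y \<and> E y z \<and> E x z)"

definition maximal_triangle_free :: "'a set \<Rightarrow> ('a \<Rightarrow> 'a \<Rightarrow> bool) \<Rightarrow> bool" where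
  "maximal_triangle_free V E \<longleftrightarrow> triangle_free V E \<and>
     (\<forall>u\<in>V. \<forall>v\<in>V. u \<noteq> v \<and> \<not> E u v \<longrightarrow> (\<exists>w\<in>V. E u w \<and> E w v))"

definition property_D :: "nat \<Rightarrow> 'a set \<Rightarrow> ('a \<Rightarrow> 'a \<Rightarrow> bool) \<Rightarrow> bool" where
  "property_D k V E \<longleftrightarrow> (\<forall>m\<in>{1..k}. \<forall>x :: nat \<Rightarrow> 'a. (\<forall>i<3*m. x i \<in> V) \<longrightarrow>
     (\<exists>y\<in>V. card {i. i < 3*m \<and> E (x i) y} \<ge> m + 1))"

text \<open>Andrasfai graph Gamma_k on vertices {0..<3k-1} (representatives of Z/(3k-1)Z).\<close>
definition andrasfai_adj :: "nat \<Rightarrow> nat \<Rightarrow> nat \<Rightarrow> bool" where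
  "andrasfai_adj k i j \<longleftrightarrow>
     (int i - int j) mod int (3*k - 1) \<in> {int k .. int (2*k - 1)}"

text \<open>G is a blow-up of H (vertex set W, adjacency F): there is a surjection
  phi from V onto W (the non-empty parts are its fibres) with E u v iff F (phi u) (phi v).\<close>
definition blowup_of :: "'a set \<Rightarrow> ('a \<Rightarrow> 'a \<Rightarrow> bool) \<Rightarrow> 'b set \<Rightarrow> ('b \<Rightarrow> 'b \<Rightarrow> bool) \<Rightarrow> bool" where
  "blowup_of V E W F \<longleftrightarrow> (\<exists>\<phi>. \<phi> ` V = W \<and>
     (\<forall>u\<in>V. \<forall>v\<in>V. E u v \<longleftrightarrow> F (\<phi> u) (\<phi> v)))"

text \<open>Mycielski-Groetzsch graph on {0..<11}: a_j = j, b_j = 5 + j (j<5), c = 10.\<close>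
definition ups_adj1 :: "nat \<Rightarrow> nat \<Rightarrow> bool" where
  "ups_adj1 u v \<longleftrightarrow> (\<exists>j<5. (u = j \<and> v = 10)
     \<or> (u = j \<and> v = 5 + (j + 2) mod 5)
     \<or> (u = j \<and> v = 5 + (j + 3) mod 5)
     \<or> (u = 5 + j \<and> v = 5 + (j + 2) mod 5))"

definition ups_adj :: "nat \<Rightarrow> nat \<Rightarrow> bool" where
  "ups_adj u v \<longleftrightarrow> ups_adj1 u v \<or> ups_adj1 v u"

definition contains_upsilon :: "'a set \<Rightarrow> ('a \<Rightarrow> 'a \<Rightarrow> bool) \<Rightarrow> bool" where
  "contains_upsilon V E \<longleftrightarrow> (\<exists>f :: nat \<Rightarrow> 'a. inj_on f {0..<11} \<and> f ` {0..<11} \<subseteq> V \<and>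
     (\<forall>u<11. \<forall>v<11. ups_adj u v \<longrightarrow> E (f u) (f v)))"

end

theory Submission
  imports Defs
begin

text \<open>
  Let three independent vertices \<open>x\<^sub>1, x\<^sub>2, x\<^sub>3\<close> have no common neighbour. Their pairwise common
  neighbours \<open>y\<^sub>i\<close> complete them to a hexagon, and \<open>\<D>\<^sub>2\<close> and \<open>\<D>\<^sub>3\<close> provide
  a common neighbour of the \<open>y\<^sub>i\<close> and common neighbours \<open>z\<^sub>i\<close> of \<open>x\<^sub>i, y\<^sub>i\<close> such that one \<open>z\<^sub>i\<close>, say
  \<open>z\<^sub>1\<close>, is adjacent to the other two. Now \<open>\<D>\<^sub>2\<close> applied to the hexagon
  \<open>x\<^sub>2 z\<^sub>2 y\<^sub>2 x\<^sub>3 z\<^sub>3 y\<^sub>3\<close> gives a vertex that completes this configuration to \<open>\<Upsilon>\<close>.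
  So all independent triples have common neighbours. The same configuration then
  excludes induced hexagons, and without these all independent sets have common
  neighbours: \<open>G\<close> belongs to Pach's class.

  In Pach's class, \<open>\<Gamma>\<^sub>k\<close> appears in its representation on \<open>{0, \<dots>, 3k - 2}\<close> where \<open>i, j\<close> are
  adjacent iff \<open>\<bar>i - j\<bar>\<close> is 1 modulo 3; it is mapped to the circulant one by \<open>i \<mapsto> k i\<close>.
  After identifying twins, a vertex \<open>u\<close> whose neighbourhood is as close as possible to that of \<open>x\<close>
  satisfies \<open>N(u) = N(x) - y + w\<close>, and then \<open>N(z) = N(y) - w + u\<close> for some \<open>z\<close>. Iterating gives a
  sequence \<open>p\<close> with \<open>N(p\<^sub>i\<^sub>+\<^sub>3) = N(p\<^sub>i) - p\<^sub>i\<^sub>+\<^sub>1 + p\<^sub>i\<^sub>+\<^sub>2\<close>, whose first period is the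
  required enumeration of all vertices.
\<close>

section \<open>Triangle-free graphs and copies of \<Upsilon>\<close>

locale triangle_free_graph =
  fixes V :: "'a set" and E :: "'a \<Rightarrow> 'a \<Rightarrow> bool"
  assumes finite_V: "finite V"
    and edge_in: "E u v \<Longrightarrow> u \<in> V \<and> v \<in> V"
    and sym: "E u v \<Longrightarrow> E v u"
    and no_triangle: "E x y \<Longrightarrow> E y z \<Longrightarrow> \<not> E x z"
begin

lemma irrefl: "\<not> E x x"
  using no_triangle by blast

lemma sym_iff: "E u v \<longleftrightarrow> E v u"
  using sym by blast

lemma ends_of_path_neq: "E p x \<Longrightarrow> E p q \<Longrightarrow> E q y \<Longrightarrow> x \<noteq> y"
  using no_triangle by blast

lemma common_neighbour_not_adjacent: "E y u \<Longrightarrow> E y v \<Longrightarrow> \<not> E u v"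
  using no_triangle by blast

text \<open>In a triangle-free graph every homomorphic image of Upsilon is injective, because any
  two of its vertices are joined by a path of length 1 or 3.\<close>
lemma contains_upsilonI:
  assumes "E a0 c" "E a1 c" "E a2 c" "E a3 c" "E a4 c"
    and "E a0 b2" "E a1 b3" "E a2 b4" "E a3 b0" "E a4 b1"
    and "E a0 b3" "E a1 b4" "E a2 b0" "E a3 b1" "E a4 b2"
    and "E b0 b2" "E b1 b3" "E b2 b4" "E b3 b0" "E b4 b1"
  shows "contains_upsilon V E"
proof -
  let ?l = "[a0, a1, a2, a3, a4, b0, b1, b2, b3, b4, c]"
  let ?f = "\<lambda>i. ?l ! i"
  note es = assms assms[THEN sym]
  have nadj: "E u v \<Longrightarrow> u \<noteq> v" for u v
    using irrefl by blast
  have "distinct ?l"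
    by (simp, intro conjI; (rule nadj, rule es | rule ends_of_path_neq, rule es, rule es, rule es))
  then have inj: "inj_on ?f {0..<11}"
    by (simp add: inj_on_def nth_eq_iff_index_eq)
  have rng: "?f ` {0..<11} \<subseteq> V"
  proof -
    have "set ?l \<subseteq> V" using assms edge_in by simp
    moreover have "?f ` {0..<11} \<subseteq> set ?l"
      by (intro image_subsetI nth_mem) simp
    ultimately show ?thesis by blast
  qed
  have "E (?f u) (?f v)" if "ups_adj1 u v" for u v
  proof -
    from that obtain j where j: "j < 5" and d: "(u = j \<and> v = 10) \<or> (u = j \<and> v = 5 + (j + 2) mod 5)
      \<or> (u = j \<and> v = 5 + (j + 3) mod 5) \<or> (u = 5 + j \<and> v = 5 + (j + 2) mod 5)"
      unfolding ups_adj1_def by blast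
    from j have "j = 0 \<or> j = 1 \<or> j = 2 \<or> j = 3 \<or> j = 4" by linarith
    with d show ?thesis
      by (elim disjE conjE) (simp_all add: assms)
  qed
  then have "E (?f u) (?f v)" if "ups_adj u v" for u v
    using that sym unfolding ups_adj_def by blast
  with inj rng show ?thesis
    unfolding contains_upsilon_def by blast
qed

lemma property_D_list:
  assumes "property_D k V E" "1 \<le> m" "m \<le> k" "length xs = 3 * m" "set xs \<subseteq> V"
  shows "\<exists>y\<in>V. m + 1 \<le> length (filter (\<lambda>x. E y x) xs)"
proof -
  have "\<forall>i<3*m. xs ! i \<in> V" using assms by (metis nth_mem subsetD)
  then obtain y where "y \<in> V" "card {i. i < 3*m \<and> E (xs ! i) y} \<ge> m + 1"
    using assms unfolding property_D_def by (metis atLeastAtMost_iff)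
  moreover have "{i. i < 3*m \<and> E (xs ! i) y} = {i. i < length xs \<and> E y (xs ! i)}"
    using assms(4) sym_iff by auto
  ultimately show ?thesis
    by (auto simp: length_filter_conv_card)
qed

end

section \<open>Common neighbours of independent sets from \<open>\<D>\<^sub>3\<close>\<close>

locale upsilon_free_graph = triangle_free_graph +
  assumes upsilon_free: "\<not> contains_upsilon V E"
    and common_neighbour: "\<lbrakk>u \<in> V; v \<in> V; \<not> E u v\<rbrakk> \<Longrightarrow> \<exists>w. E w u \<and> E w v"
begin

text \<open>The twenty edges are those of \<Upsilon>: the centre is \<open>y2\<close>, and its
  neighbours \<open>w, x3, v, x1, z2\<close> attach to the pentagon
  \<open>y3 x2 y1 z1 z3\<close>.\<close>

lemma no_upsilon_on_cube:
  assumes "E x1 y2" "E x1 y3" "E x2 y1" "E x2 y3" "E x3 y1" "E x3 y2"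
    and "E v y1" "E v y2" "E v y3"
    and "E z1 x1" "E z1 y1" "E z2 x2" "E z2 y2" "E z3 x3" "E z3 y3" "E z1 z2" "E z1 z3"
    and "E w x2" "E w y2" "E w z3"
  shows False
proof -
  note es = assms assms[THEN sym]
  have "contains_upsilon V E"
    by (rule contains_upsilonI[where c = y2 and ?b0.0 = y3 and ?b2.0 = x2 and ?b4.0 = y1
          and ?b1.0 = z1 and ?b3.0 = z3 and ?a0.0 = w and ?a2.0 = v and ?a4.0 = z2
          and ?a1.0 = x3 and ?a3.0 = x1]) (rule es)+
  with upsilon_free show False ..
qed

lemma property_D2:
  assumes "property_D 3 V E" "{x1, x2, x3, x4, x5, x6} \<subseteq> V"
  shows "\<exists>y\<in>V. 3 \<le> length (filter (E y) [x1, x2, x3, x4, x5, x6])"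
  using property_D_list[OF assms(1), of 2 "[x1, x2, x3, x4, x5, x6]"] assms(2) by (simp del: filter.simps)

lemma property_D3:
  assumes "property_D 3 V E" "{x1, x2, x3, x4, x5, x6, x7, x8, x9} \<subseteq> V"
  shows "\<exists>y\<in>V. 4 \<le> length (filter (E y) [x1, x2, x3, x4, x5, x6, x7, x8, x9])"
  using property_D_list[OF assms(1), of 3 "[x1, x2, x3, x4, x5, x6, x7, x8, x9]"] assms(2) by (simp del: filter.simps)

text \<open>No two consecutive vertices of the hexagon \<open>x1 y2 x3 y1 x2 y3\<close> share a
  neighbour, so the three neighbours supplied by \<open>\<D>\<^sub>2\<close> form one of its colour
  classes.\<close>

lemma hexagon_property_D:
  assumes "property_D 3 V E"
    and "E x1 y2" "E x1 y3" "E x2 y1" "E x2 y3" "E x3 y1" "E x3 y2"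
  shows "(\<exists>w. E w x1 \<and> E w x2 \<and> E w x3) \<or> (\<exists>w. E w y1 \<and> E w y2 \<and> E w y3)"
proof -
  obtain w where w: "3 \<le> length (filter (E w) [x1, x2, x3, y1, y2, y3])"
    using property_D2[OF assms(1), of x1 x2 x3 y1 y2 y3] assms(2-) edge_in by blast
  have "\<not> (E w x \<and> E w y)" if "E x y" for x y
    using that common_neighbour_not_adjacent by blast
  from this[OF assms(2)] this[OF assms(3)] this[OF assms(4)] this[OF assms(5)] this[OF assms(6)]
    this[OF assms(7)] w
  show ?thesis by (cases "E w x1"; cases "E w x2"; cases "E w x3"; auto split: if_splits)
qed

lemma property_D_triple_config:
  assumes D: "property_D 3 V E"
    and xs: "\<not> (\<exists>w. E w x1 \<and> E w x2 \<and> E w x3)"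
    and xy: "E x1 y2" "E x1 y3" "E x2 y1" "E x2 y3" "E x3 y1" "E x3 y2"
    and z2: "E z2 x2" "E z2 y2" and z3: "E z3 x3" "E z3 y3"
    and z1: "E z1 x1" "E z1 y1" "E z1 z2" "E z1 z3"
  shows False
proof -
  obtain v where v: "E v y1" "E v y2" "E v y3"
    using hexagon_property_D[OF D xy] xs by blast
  \<comment> \<open>Either colour class of the hexagon \<open>x2 z2 y2 x3 z3 y3\<close> yields the
    last vertex \<open>w\<close> of \<open>no_upsilon_on_cube\<close>, the second one after
    exchanging the indices 2 and 3.\<close>
  have "(\<exists>w. E w x2 \<and> E w y2 \<and> E w z3) \<or> (\<exists>w. E w x3 \<and> E w y3 \<and> E w z2)"
    using hexagon_property_D[OF D, of x2 y3 z2 y2 x3 z3] xy z2 z3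
      xy(6)[THEN sym] z2[THEN sym] by blast
  then show False
    using no_upsilon_on_cube[of x1 y2 y3 x2 y1 x3 v z1 z2 z3]
      no_upsilon_on_cube[of x1 y3 y2 x3 y1 x2 v z1 z3 z2] xy z1 z2 z3 v by blast
qed

lemma independent_triple_common_neighbour:
  assumes D: "property_D 3 V E"
    and V: "x1 \<in> V" "x2 \<in> V" "x3 \<in> V"
    and ind: "\<not> E x1 x2" "\<not> E x1 x3" "\<not> E x2 x3"
  shows "\<exists>w. E w x1 \<and> E w x2 \<and> E w x3"
proof (rule ccontr)
  assume xs: "\<not> ?thesis"
  obtain y1 where y1: "E x2 y1" "E x3 y1" using common_neighbour[of x2 x3] V ind sym by blast
  obtain y2 where y2: "E x1 y2" "E x3 y2" using common_neighbour[of x1 x3] V ind sym by blast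
  obtain y3 where y3: "E x1 y3" "E x2 y3" using common_neighbour[of x1 x2] V ind sym by blast
  have nxy: "\<not> E x1 y1" "\<not> E x2 y2" "\<not> E x3 y3"
    using xs y1 y2 y3 sym by blast+
  have yV: "y1 \<in> V" "y2 \<in> V" "y3 \<in> V" using y1 y2 y3 edge_in by blast+
  obtain z1 where z1: "E z1 x1" "E z1 y1" using common_neighbour[of x1 y1] V yV nxy by blast
  obtain z2 where z2: "E z2 x2" "E z2 y2" using common_neighbour[of x2 y2] V yV nxy by blast
  obtain z3 where z3: "E z3 x3" "E z3 y3" using common_neighbour[of x3 y3] V yV nxy by blast
  obtain w where w: "4 \<le> length (filter (E w) [x1, x2, x3, y1, y2, y3, z1, z2, z3])"
    using property_D3[OF D, of x1 x2 x3 y1 y2 y3 z1 z2 z3] V yV z1 z2 z3 edge_in by blast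
  have no: "\<not> (E w x \<and> E w y)" if "E x y" for x y
    using that common_neighbour_not_adjacent by blast
  have "\<not> (E w x1 \<and> E w x2 \<and> E w x3)" using xs by blast
  \<comment> \<open>Adjacency to two of the \<open>xi\<close> excludes all \<open>yi\<close> and two
    of the \<open>zi\<close>; adjacency to none leaves at most one of \<open>yi\<close>,
    \<open>zi\<close> for each \<open>i\<close>. So \<open>w\<close> sees exactly one
    \<open>xi\<close>, and four neighbours force \<open>yi\<close> and the other two
    \<open>zj\<close>. Then \<open>w\<close> takes the place of \<open>zi\<close>.\<close>
  with no[OF y1(1)] no[OF y1(2)] no[OF y2(1)] no[OF y2(2)] no[OF y3(1)] no[OF y3(2)]
    no[OF z1(1)] no[OF z1(2)] no[OF z2(1)] no[OF z2(2)] no[OF z3(1)] no[OF z3(2)] w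
  have "(E w x1 \<and> E w y1 \<and> E w z2 \<and> E w z3) \<or> (E w x2 \<and> E w y2 \<and> E w z1 \<and> E w z3)
      \<or> (E w x3 \<and> E w y3 \<and> E w z1 \<and> E w z2)"
    by (cases "E w x1"; cases "E w x2"; cases "E w x3"; cases "E w y1"; cases "E w y2"; cases "E w y3";
        simp split: if_splits)
  then show False
  proof (elim disjE)
    assume "E w x1 \<and> E w y1 \<and> E w z2 \<and> E w z3"
    then show False
      using property_D_triple_config[OF D, of x1 x2 x3 y2 y3 y1 z2 z3 w] xs y1 y2 y3 z2 z3 by blast
  next
    assume "E w x2 \<and> E w y2 \<and> E w z1 \<and> E w z3"
    then show False
      using property_D_triple_config[OF D, of x2 x1 x3 y1 y3 y2 z1 z3 w] xs y1 y2 y3 z1 z3 by blast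
  next
    assume "E w x3 \<and> E w y3 \<and> E w z1 \<and> E w z2"
    then show False
      using property_D_triple_config[OF D, of x3 x2 x1 y2 y1 y3 z2 z1 w] xs y1 y2 y3 z1 z2 by blast
  qed
qed

text \<open>Common neighbours of pairs and triples supply all further vertices of
  \<open>no_upsilon_on_cube\<close>: \<open>v\<close> from the \<open>yi\<close>, \<open>z1\<close>
  from \<open>x1, y1\<close>, then \<open>z2\<close> and \<open>z3\<close> from
  \<open>xi, yi, z1\<close>, and \<open>w\<close> from \<open>x2, y2, z3\<close>.\<close>

lemma no_induced_hexagon:
  assumes triple: "\<And>a b c. \<lbrakk>a \<in> V; b \<in> V; c \<in> V; \<not> E a b; \<not> E a c; \<not> E b c\<rbrakk>
      \<Longrightarrow> \<exists>w. E w a \<and> E w b \<and> E w c"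
    and xy: "E x1 y2" "E x1 y3" "E x2 y1" "E x2 y3" "E x3 y1" "E x3 y2"
    and nxy: "\<not> E x1 y1" "\<not> E x2 y2" "\<not> E x3 y3"
  shows False
proof -
  have V: "x1 \<in> V" "x2 \<in> V" "x3 \<in> V" "y1 \<in> V" "y2 \<in> V" "y3 \<in> V"
    using xy edge_in by blast+
  have "\<not> E y1 y2" "\<not> E y1 y3" "\<not> E y2 y3"
    using xy common_neighbour_not_adjacent by blast+
  then obtain v where v: "E v y1" "E v y2" "E v y3"
    using triple V by blast
  obtain z1 where z1: "E z1 x1" "E z1 y1"
    using common_neighbour[of x1 y1] V nxy by blast
  have nz1: "\<not> E z1 x2" "\<not> E z1 x3" "\<not> E z1 y2" "\<not> E z1 y3"
    using z1 xy sym no_triangle by blast+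
  obtain z2 where z2: "E z2 x2" "E z2 y2" "E z2 z1"
    using triple[of x2 y2 z1] V z1 nz1 nxy edge_in sym by blast
  obtain z3 where z3: "E z3 x3" "E z3 y3" "E z3 z1"
    using triple[of x3 y3 z1] V z1 nz1 nxy edge_in sym by blast
  have "\<not> E x2 z3" "\<not> E y2 z3"
    using z3 xy sym no_triangle by blast+
  then obtain w where "E w x2" "E w y2" "E w z3"
    using triple[of x2 y2 z3] V z3 nxy edge_in by blast
  then show False
    using no_upsilon_on_cube[of x1 y2 y3 x2 y1 x3 v z1 z2 z3 w] xy v z1 z2 z3 sym by blast
qed

text \<open>By induction there are, for three elements \<open>xi\<close> of \<open>S\<close>,
  vertices \<open>yi\<close> adjacent to all of \<open>S\<close> except perhaps \<open>xi\<close>.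
  If each \<open>yi\<close> missed its \<open>xi\<close>, then \<open>y1 x2 y3 x1 y2 x3\<close>
  would be an induced hexagon.\<close>

lemma independent_common_neighbour:
  assumes D: "property_D 3 V E" and ne: "V \<noteq> {}"
    and S: "S \<subseteq> V" "\<And>u v. u \<in> S \<Longrightarrow> v \<in> S \<Longrightarrow> \<not> E u v"
  shows "\<exists>w\<in>V. \<forall>s\<in>S. E w s"
proof -
  have "finite S" using S(1) finite_V finite_subset by blast
  then show ?thesis using S
  proof (induction "card S" arbitrary: S rule: less_induct)
    case less
    note triple = independent_triple_common_neighbour[OF D]
    have IH: "\<exists>w\<in>V. \<forall>s\<in>S - {x}. E w s" if "x \<in> S" for x
    proof (rule less.hyps)
      show "card (S - {x}) < card S" using less.prems(1) that by (rule card_Diff1_less)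
    qed (use less.prems in auto)
    \<comment> \<open>The first case is \<open>card S \<le> 3\<close>: \<open>a, b, c\<close> may
      coincide, and they are arbitrary if \<open>S\<close> is empty.\<close>
    show ?case
    proof (cases "\<exists>a\<in>V. \<exists>b\<in>V. \<exists>c\<in>V. S \<subseteq> {a, b, c} \<and> (S = {} \<or> {a, b, c} \<subseteq> S)")
      case True
      then obtain a b c where abc: "a \<in> V" "S \<subseteq> {a, b, c}" "S = {} \<or> {a, b, c} \<subseteq> S"
        by blast
      show ?thesis
      proof (cases "S = {}")
        case False
        then have "\<exists>w. E w a \<and> E w b \<and> E w c"
          using abc less.prems by (intro triple) auto
        then show ?thesis using abc(2) edge_in by blast
      qed (use abc in blast)
    next
      case False
      have "S \<noteq> {}" using False ne by blast
      then obtain x1 where x1: "x1 \<in> S" by blast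
      then have "\<not> S \<subseteq> {x1}" using False less.prems by blast
      then obtain x2 where x2: "x2 \<in> S" "x2 \<noteq> x1" by blast
      then have "\<not> S \<subseteq> {x1, x2}" using x1 False less.prems by blast
      then obtain x3 where x3: "x3 \<in> S" "x3 \<noteq> x1" "x3 \<noteq> x2" by blast
      obtain y1 where y1: "y1 \<in> V" "\<forall>s\<in>S - {x1}. E y1 s" using IH x1 by blast
      obtain y2 where y2: "y2 \<in> V" "\<forall>s\<in>S - {x2}. E y2 s" using IH x2 by blast
      obtain y3 where y3: "y3 \<in> V" "\<forall>s\<in>S - {x3}. E y3 s" using IH x3 by blast
      have "E y1 x1 \<or> E y2 x2 \<or> E y3 x3"
        using no_induced_hexagon[OF triple, of y1 x2 x3 y2 x1 y3] x1 x2 x3 y1 y2 y3 by blast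
      then show ?thesis using y1 y2 y3 by blast
    qed
  qed
qed

end

section \<open>Pach's class\<close>

text \<open>The second axiom makes the neighbourhoods exactly the maximal independent sets (Pach's class).\<close>
locale pach_graph = triangle_free_graph +
  assumes nonempty: "V \<noteq> {}"
    and indep_common_neighbour:
      "\<lbrakk>S \<subseteq> V; \<And>u v. u \<in> S \<Longrightarrow> v \<in> S \<Longrightarrow> \<not> E u v\<rbrakk> \<Longrightarrow> \<exists>w\<in>V. \<forall>s\<in>S. E w s"
    and no_hexagon:
      "\<lbrakk>E x1 y2; E x1 y3; E x2 y1; E x2 y3; E x3 y1; E x3 y2\<rbrakk>
        \<Longrightarrow> E x1 y1 \<or> E x2 y2 \<or> E x3 y3"
begin

definition nbh :: "'a \<Rightarrow> 'a set" where
  "nbh x = {y. E x y}"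

lemma mem_nbh [simp]: "y \<in> nbh x \<longleftrightarrow> E x y"
  by (simp add: nbh_def)

lemma finite_nbh [simp]: "finite (nbh x)"
  using finite_V edge_in by (auto simp: nbh_def intro: finite_subset)

lemma triple_common_neighbour:
  assumes "a \<in> V" "b \<in> V" "c \<in> V" "\<not> E a b" "\<not> E a c" "\<not> E b c"
  shows "\<exists>w. E w a \<and> E w b \<and> E w c"
  using indep_common_neighbour[of "{a, b, c}"] assms irrefl sym by auto

text \<open>A neighbour \<open>w\<close> of \<open>v\<close> missed by \<open>u\<close> would share
  a neighbour \<open>t\<close> with \<open>u\<close>, and \<open>t v w\<close> would be a
  triangle.\<close>

lemma nbh_subset_eq:
  assumes "u \<in> V" "v \<in> V" "nbh u \<subseteq> nbh v"
  shows "nbh u = nbh v"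
proof -
  have "E u w" if vw: "E v w" for w
  proof (rule ccontr)
    assume "\<not> E u w"
    then obtain t where "E t u" "E t w"
      using triple_common_neighbour[of u w w] assms(1) edge_in[OF vw] irrefl by blast
    then show False using vw assms(3) no_triangle sym by (meson mem_nbh subsetD)
  qed
  then show ?thesis using assms(3) by auto
qed

text \<open>If both missed \<open>c\<close>, common neighbours \<open>p\<close> of
  \<open>u, b, c\<close> and \<open>q\<close> of \<open>s, a, c\<close> would close an induced
  hexagon \<open>u a q s b p\<close>. Hence the traces of \<open>u\<close> and \<open>s\<close> on
  \<open>nbh x\<close> are nested or cover it.\<close>

lemma traces_nested_or_covering:
  assumes "x \<in> V" "u \<in> V" "s \<in> V" "\<not> E u s"
    and "E x a" "E x b" "E x c" "E u a" "\<not> E s a" "E s b" "\<not> E u b"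
  shows "E u c \<or> E s c"
proof (rule ccontr)
  assume nc: "\<not> ?thesis"
  have abc: "\<not> E a b" "\<not> E a c" "\<not> E b c"
    using assms no_triangle by blast+
  have V: "a \<in> V" "b \<in> V" "c \<in> V" using assms edge_in by blast+
  obtain p where p: "E p u" "E p b" "E p c"
    using triple_common_neighbour[of u b c] assms V abc nc by blast
  obtain q where q: "E q s" "E q a" "E q c"
    using triple_common_neighbour[of s a c] assms V abc nc by blast
  have "E u s \<or> E b a \<or> E q p"
    using no_hexagon[of u a p b s q] assms p q sym by blast
  then show False
    using assms abc p q sym no_triangle by blast
qed

end

section \<open>Twin-free graphs and one-vertex exchanges of neighbourhoods\<close>

locale reduced_pach_graph = pach_graph +
  assumes twin_free: "\<lbrakk>u \<in> V; v \<in> V; nbh u = nbh v\<rbrakk> \<Longrightarrow> u = v"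
begin

lemma nbh_not_subset:
  assumes "u \<in> V" "v \<in> V" "u \<noteq> v"
  obtains w where "E u w" "\<not> E v w"
  using assms nbh_subset_eq twin_free by (metis mem_nbh subsetI)

text \<open>Maximality forces all edges between \<open>nbh x - nbh u\<close> and
  \<open>nbh u - nbh x\<close>. Two elements of one difference would be separated by some
  \<open>s\<close>, as there are no twins; this \<open>s\<close> has a larger trace in the first
  case and satisfies \<open>nbh s = nbh u\<close> in the second, both absurd.\<close>

lemma maximal_trace:
  assumes V: "x \<in> V" "u \<in> V" and "u \<noteq> x" and xu: "\<not> E x u"
    and max: "\<And>s. s \<in> V \<Longrightarrow> s \<noteq> x \<Longrightarrow> \<not> nbh x \<inter> nbh u \<subset> nbh x \<inter> nbh s"
  shows "\<exists>y w. E x y \<and> \<not> E x w \<and> E y w \<and> nbh u = insert w (nbh x - {y})"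
proof -
  have complete: "E y w" if y: "E x y" "\<not> E u y" and w: "E u w" "\<not> E x w" for y w
  proof (rule ccontr)
    assume yw: "\<not> E y w"
    let ?S = "insert y (insert w (nbh x \<inter> nbh u))"
    \<comment> \<open>If \<open>y\<close> and \<open>w\<close> are non-adjacent, \<open>?S\<close>
      is independent. A common neighbour of it adds \<open>y\<close> to the trace of
      \<open>u\<close>, and it differs from \<open>x\<close> because it sees
      \<open>w\<close>.\<close>
    obtain s where s: "s \<in> V" "\<forall>t\<in>?S. E s t"
    proof -
      have "?S \<subseteq> V" using y w edge_in by auto
      moreover have "\<not> E a b" if "a \<in> ?S" "b \<in> ?S" for a b
      proof -
        have "(E x a \<and> E x b) \<or> (E u a \<and> E u b) \<or> (a = y \<and> b = w) \<or> (a = w \<and> b = y)"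
          using that y w by auto
        then show ?thesis
          using yw sym[of w y] common_neighbour_not_adjacent by blast
      qed
      ultimately show ?thesis using indep_common_neighbour that by meson
    qed
    then have "nbh x \<inter> nbh u \<subset> nbh x \<inter> nbh s" "s \<noteq> x"
      using y w by auto
    with max s(1) show False by blast
  qed
  obtain y where y: "E x y" "\<not> E u y" using nbh_not_subset V \<open>u \<noteq> x\<close> by metis
  obtain w where w: "E u w" "\<not> E x w" using nbh_not_subset V \<open>u \<noteq> x\<close> by metis
  have y_unique: "y' = y" if y': "E x y'" "\<not> E u y'" for y'
  proof (rule ccontr)
    assume "y' \<noteq> y"
    then obtain s where s: "E y s" "\<not> E y' s"
      using nbh_not_subset y(1) y'(1) edge_in by metis
    have "\<not> E x s" using s(1) y(1) no_triangle by blast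
    then have "\<not> E u s" using complete[OF y'] s(2) by blast
    \<comment> \<open>Both \<open>u\<close> and \<open>s\<close> miss \<open>y'\<close>, so their
      traces do not cover \<open>nbh x\<close>; they are nested, and only that of \<open>s\<close>
      contains \<open>y\<close>.\<close>
    have "E s t" if "E x t" "E u t" for t
      using traces_nested_or_covering[of x u s t y y'] that V s y y' \<open>\<not> E u s\<close> edge_in sym by blast
    then have "nbh x \<inter> nbh u \<subset> nbh x \<inter> nbh s"
      using y s sym by auto
    moreover have "s \<noteq> x" using s y' sym by blast
    ultimately show False using max s(1) edge_in by blast
  qed
  have w_unique: "w' = w" if w': "E u w'" "\<not> E x w'" for w'
  proof (rule ccontr)
    assume "w' \<noteq> w"
    then obtain s where s: "E w s" "\<not> E w' s"
      using nbh_not_subset w(1) w'(1) edge_in by metis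
    have us: "\<not> E u s" using s(1) w(1) no_triangle by blast
    have ys: "\<not> E y s" using s(1) complete[OF y w] no_triangle by blast
    have xs: "\<not> E x s" using us y_unique complete[OF y w'] s(2) sym by blast
    have sV: "s \<in> V" using s edge_in by blast
    have T: "E s t" if "E x t" "E u t" for t
      using traces_nested_or_covering[of u x s t w w'] that V sV s w w' xs sym by blast
    \<comment> \<open>A neighbour \<open>f\<close> of \<open>s\<close> outside \<open>nbh u\<close>
      is also outside \<open>nbh x\<close>. A common neighbour of \<open>u, x, f\<close> is adjacent
      to \<open>s\<close> by \<open>T\<close>, which gives a triangle.\<close>
    have "E u f" if sf: "E s f" for f
    proof (rule ccontr)
      assume uf: "\<not> E u f"
      then have "\<not> E x f" using y_unique[of f] ys sf sym by blast
      then obtain t where "E t u" "E t x" "E t f"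
        using triple_common_neighbour[of u x f] V uf xu edge_in[OF sf] sym by blast
      then show False using T sf sym no_triangle by blast
    qed
    then have "nbh s \<subseteq> nbh u" by auto
    then have "nbh s = nbh u" using nbh_subset_eq sV V(2) by blast
    then show False using w'(1) s(2) sym by (metis mem_nbh)
  qed
  have "nbh u = insert w (nbh x - {y})"
  proof (rule set_eqI)
    fix v
    show "v \<in> nbh u \<longleftrightarrow> v \<in> insert w (nbh x - {y})"
      using y w y_unique[of v] w_unique[of v] by (cases "E x v"; cases "E u v") auto
  qed
  then show ?thesis using y(1) w(2) complete[OF y w] by blast
qed

text \<open>In \<open>\<Gamma>\<^sub>k\<close> these are the quadruples \<open>(x, x + k, x + 2k, x + 3k)\<close>, where \<open>x + 3k = x + 1\<close>.\<close>
definition swap :: "'a \<Rightarrow> 'a \<Rightarrow> 'a \<Rightarrow> 'a \<Rightarrow> bool" where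
  "swap x y w u \<longleftrightarrow> u \<in> V \<and> E x y \<and> E y w \<and> \<not> E x w \<and> \<not> E x u
     \<and> nbh u = insert w (nbh x - {y})"

text \<open>Take \<open>u\<close> with the largest trace on \<open>nbh x\<close>. Since
  \<open>u0\<close> shares a neighbour with \<open>x\<close>, this trace is non-empty, so
  \<open>u\<close> is not adjacent to \<open>x\<close>.\<close>

lemma swap_exists:
  assumes V: "x \<in> V" "u0 \<in> V" and "u0 \<noteq> x" "\<not> E x u0"
  shows "\<exists>y w u. swap x y w u"
proof -
  let ?A = "{u \<in> V. u \<noteq> x}" and ?f = "\<lambda>s. card (nbh x \<inter> nbh s)"
  have fin: "finite (?f ` ?A)" using finite_V by simp
  have "Max (?f ` ?A) \<in> ?f ` ?A" using assms by (intro Max_in fin) auto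
  then obtain u where u: "u \<in> V" "u \<noteq> x" and Max: "Max (?f ` ?A) = ?f u" by auto
  have max: "?f s \<le> ?f u" if "s \<in> V" "s \<noteq> x" for s
    using Max_ge[OF fin, of "?f s"] that Max by auto
  obtain t where "E t x" "E t u0" using triple_common_neighbour[of x u0 u0] assms irrefl by blast
  then have "t \<in> nbh x \<inter> nbh u0" using sym by simp
  then have "nbh x \<inter> nbh u0 \<noteq> {}" by blast
  then have "?f u0 \<noteq> 0" by simp
  then have "?f u \<noteq> 0" using max[OF V(2) \<open>u0 \<noteq> x\<close>] by linarith
  then have "nbh x \<inter> nbh u \<noteq> {}" by (metis card.empty)
  then obtain t' where "t' \<in> nbh x" "t' \<in> nbh u" by blast
  then have xu: "\<not> E x u" by (meson mem_nbh no_triangle sym)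
  have "\<not> nbh x \<inter> nbh u \<subset> nbh x \<inter> nbh s" if "s \<in> V" "s \<noteq> x" for s
    using max[OF that] psubset_card_mono[of "nbh x \<inter> nbh s"]
    by (meson finite_Int finite_nbh leD)
  from maximal_trace[OF V(1) u xu this] show ?thesis
    unfolding swap_def using u(1) xu by blast
qed

text \<open>Neighbours of \<open>u\<close> other than \<open>w\<close> are neighbours of
  \<open>x\<close>, hence not of \<open>y\<close>; so \<open>u\<close> and
  \<open>nbh y - {w}\<close> have a common neighbour \<open>z\<close>. Its trace on
  \<open>nbh y\<close> lacks only \<open>w\<close>, and a larger trace would belong to a twin of
  \<open>y\<close>, so \<open>maximal_trace\<close> applies.\<close>

lemma swap_step:
  assumes sw: "swap x y w u"
  shows "\<exists>z. swap y w u z"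
proof -
  have *: "u \<in> V" "E x y" "E y w" "\<not> E x w" "\<not> E x u" "nbh u = insert w (nbh x - {y})"
    using sw unfolding swap_def by auto
  have nu: "E u v \<longleftrightarrow> v = w \<or> (E x v \<and> v \<noteq> y)" for v
    using *(6) by (metis mem_nbh insert_iff Diff_iff singleton_iff)
  have yu: "\<not> E y u" using nu[of y] * irrefl sym by blast
  have uw: "E u w" using nu by blast
  let ?S = "insert u (nbh y - {w})"
  obtain z where z: "z \<in> V" "\<forall>t\<in>?S. E z t"
  proof -
    have "?S \<subseteq> V" using *(1) edge_in by auto
    moreover have "\<not> E g u" if "E y g" "g \<noteq> w" for g
      using that nu[of g] *(2) no_triangle sym by blast
    then have "\<not> E a b" if "a \<in> ?S" "b \<in> ?S" for a b
    proof -
      have "(E y a \<and> E y b) \<or> (a = u \<and> (b = u \<or> E y b \<and> b \<noteq> w)) \<or> (b = u \<and> E y a \<and> a \<noteq> w)"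
        using that by auto
      then show ?thesis
        using \<open>\<And>g. E y g \<Longrightarrow> g \<noteq> w \<Longrightarrow> \<not> E g u\<close> irrefl sym common_neighbour_not_adjacent by blast
    qed
    ultimately show ?thesis using indep_common_neighbour that by meson
  qed
  have zu: "E z u" using z by blast
  have zw: "\<not> E z w" using zu uw no_triangle by blast
  have "x \<noteq> w" using uw *(5) sym by blast
  then have zx: "E z x" using z sym[OF *(2)] by simp
  have yz: "\<not> E y z" using zx *(2) no_triangle sym by blast
  have "z \<noteq> y" using zu yu by blast
  have T: "nbh y \<inter> nbh z = nbh y - {w}" using z zw by auto
  have "\<not> nbh y \<inter> nbh z \<subset> nbh y \<inter> nbh s" if s: "s \<in> V" "s \<noteq> y" for s
  proof
    assume "nbh y \<inter> nbh z \<subset> nbh y \<inter> nbh s"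
    then have "nbh y - {w} \<subset> nbh y \<inter> nbh s" using T by simp
    then have "nbh y \<subseteq> nbh s" by blast
    then show False using nbh_subset_eq twin_free s *(2) edge_in by metis
  qed
  then obtain y' w' where "E y y'" "\<not> E y w'" "E y' w'" "nbh z = insert w' (nbh y - {y'})"
    using maximal_trace[of y z] *(2) edge_in z(1) \<open>z \<noteq> y\<close> yz by blast
  moreover have "y' = w"
    using calculation *(3) zw by (metis mem_nbh insert_iff Diff_iff singleton_iff)
  moreover have "w' = u"
    using calculation zu yu by (metis mem_nbh insert_iff Diff_iff)
  ultimately show ?thesis
    unfolding swap_def using z(1) yu yz by blast
qed

text \<open>Dependent choice runs over quadruples of consecutive terms, because
  \<open>swap_step\<close> extends a whole quadruple.\<close>

lemma swap_sequence_exists: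
  assumes "swap x y w u"
  shows "\<exists>p :: nat \<Rightarrow> 'a. \<forall>i. swap (p i) (p (i + 1)) (p (i + 2)) (p (i + 3))"
proof -
  have "\<exists>f. \<forall>n. (case f n of (a, b, c, d) \<Rightarrow> swap a b c d)
      \<and> (case f n of (a, b, c, d) \<Rightarrow> \<exists>z. f (Suc n) = (b, c, d, z))"
  proof (rule dependent_nat_choice)
    show "\<exists>q. case q of (a, b, c, d) \<Rightarrow> swap a b c d"
      using assms by blast
  next
    fix q :: "'a \<times> 'a \<times> 'a \<times> 'a" and n :: nat
    assume "case q of (a, b, c, d) \<Rightarrow> swap a b c d"
    then show "\<exists>r. (case r of (a, b, c, d) \<Rightarrow> swap a b c d)
        \<and> (case q of (a, b, c, d) \<Rightarrow> \<exists>z. r = (b, c, d, z))"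
      using swap_step by (cases q) fastforce
  qed
  then obtain f where sw: "\<And>n. case f n of (a, b, c, d) \<Rightarrow> swap a b c d"
    and st: "\<And>n. case f n of (a, b, c, d) \<Rightarrow> \<exists>z. f (Suc n) = (b, c, d, z)"
    by (elim exE, intro that) (drule spec, erule conjE, assumption)+
  define p where "p = (\<lambda>n. fst (f n))"
  have shift: "fst (snd (f n)) = p (Suc n)" "fst (snd (snd (f n))) = fst (snd (f (Suc n)))"
    "snd (snd (snd (f n))) = fst (snd (snd (f (Suc n))))" for n
    using st[of n] unfolding p_def by (auto split: prod.splits)
  have f: "f n = (p n, p (n + 1), p (n + 2), p (n + 3))" for n
    using shift[of n] shift[of "Suc n"] shift[of "Suc (Suc n)"]
    by (simp add: prod_eq_iff p_def numeral_3_eq_3)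
  show ?thesis
  proof (intro exI allI)
    show "swap (p i) (p (i + 1)) (p (i + 2)) (p (i + 3))" for i
      using sw[of i] unfolding f by simp
  qed
qed

end

section \<open>Periodicity of the swap sequence\<close>

locale swap_sequence = reduced_pach_graph +
  fixes p :: "nat \<Rightarrow> 'a"
  assumes swap_p: "swap (p i) (p (i + 1)) (p (i + 2)) (p (i + 3))"
begin

lemma p_in: "p i \<in> V"
  using swap_p[of i] edge_in unfolding swap_def by blast

lemma adj_1: "E (p (Suc i)) (p i)"
  using swap_p[of i] sym unfolding swap_def by simp

lemma not_adj_2: "\<not> E (p (i + 2)) (p i)"
  using swap_p[of i] sym unfolding swap_def by blast

lemma not_adj_3: "\<not> E (p (i + 3)) (p i)"
  using swap_p[of i] sym unfolding swap_def by blast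

lemma adj_add_3: "E (p (i + 3)) v \<longleftrightarrow> v = p (i + 2) \<or> E (p i) v \<and> v \<noteq> p (i + 1)"
proof -
  have "nbh (p (i + 3)) = insert (p (i + 2)) (nbh (p i) - {p (i + 1)})"
    using swap_p[of i] unfolding swap_def by blast
  then show ?thesis
    by (metis mem_nbh insert_iff Diff_iff singleton_iff)
qed

text \<open>Passing from \<open>j - 3\<close> to \<open>j\<close> affects only adjacency to
  \<open>p (j - 1)\<close> and \<open>p (j - 2)\<close>. Only these must differ from
  \<open>p i\<close>, so \<open>j = n\<close> is admissible.\<close>

lemma adj_iff_less:
  assumes inj: "inj_on p {..<n}" and "i < j" "j \<le> n"
  shows "E (p j) (p i) \<longleftrightarrow> (j - i) mod 3 = 1"
  using assms(2,3)
proof (induction j rule: less_induct)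
  case (less j)
  consider "j = Suc i" | "j = i + 2" | "j = i + 3" | "i + 3 < j"
    using less.prems by linarith
  then show ?case
  proof cases
    case 4
    obtain l where l: "j = l + 3" "i < l" 
      using 4 that[of "j - 3"] by simp
    have "p i \<noteq> p (l + 2)" "p i \<noteq> p (l + 1)"
      using inj_onD[OF inj] l less.prems by fastforce+
    then have "E (p j) (p i) \<longleftrightarrow> E (p l) (p i)"
      using adj_add_3[of l "p i"] l by simp
    also have "\<dots> \<longleftrightarrow> (l - i) mod 3 = 1"
      using less.IH[of l] l less.prems by simp
    also have "l - i + 3 = j - i" using l by simp
    then have "(l - i) mod 3 = (j - i) mod 3" by (metis mod_add_self2)
    finally show ?thesis by simp
  qed (use adj_1 not_adj_2 not_adj_3 in auto)
qed

text \<open>Let \<open>n\<close> be least such that \<open>p n\<close> equals an earlier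
  \<open>p j\<close>. The edge to \<open>p (n - 1)\<close> gives \<open>(n - j) mod 3 = 2\<close>;
  if \<open>j > 0\<close>, the edge to \<open>p (j - 1)\<close> would give
  \<open>(n - j) mod 3 = 0\<close>. So \<open>j = 0\<close>, and \<open>n = 2\<close> fails because
  \<open>p 3\<close> sees \<open>p 2\<close> but not \<open>p 0\<close>.\<close>

lemma first_return:
  obtains n where "inj_on p {..<n}" "p n = p 0" "n mod 3 = 2" "n \<ge> 5"
proof -
  have "\<exists>n. p n \<in> p ` {..<n}"
  proof (rule ccontr)
    assume no: "\<not> ?thesis"
    have "p i \<noteq> p j" if "i < j" for i j
      using no that by (metis image_eqI lessThan_iff)
    then have "inj p" by (metis injI linorder_neqE_nat)
    moreover have "finite (range p)" using finite_V p_in by (meson finite_subset image_subsetI)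
    ultimately show False using finite_imageD by blast
  qed
  then obtain n where n: "p n \<in> p ` {..<n}" and min: "\<And>m. m < n \<Longrightarrow> p m \<notin> p ` {..<m}"
    using exists_least_iff[of "\<lambda>n. p n \<in> p ` {..<n}"] by blast
  have inj: "inj_on p {..<n}"
  proof (rule linorder_inj_onI)
    fix i j assume "i < j" "i \<in> {..<n}" "j \<in> {..<n}"
    then show "p i \<noteq> p j" using min[of j] by (metis image_eqI lessThan_iff)
  qed auto
  obtain j where j: "j < n" "p n = p j" using n by auto
  have adj: "E (p j) (p i) \<longleftrightarrow> (n - i) mod 3 = 1" if "i < n" for i
    using adj_iff_less[OF inj that order_refl] j by simp
  have last: "E (p (n - 1)) (p j)" using adj[of "n - 1"] j sym by auto
  then have "j < n - 1" using j irrefl by (metis Suc_pred' diff_Suc_1 gr_implies_not0 less_SucE not_gr_zero)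
  then have r: "(n - 1 - j) mod 3 = 1" using adj_iff_less[OF inj, of j "n - 1"] last by simp
  have "j = 0"
  proof (rule ccontr)
    assume "j \<noteq> 0"
    then have "(n - (j - 1)) mod 3 = 1"
      using adj[of "j - 1"] adj_1[of "j - 1"] j by simp
    moreover have "n - (j - 1) = (n - 1 - j) + 2" using \<open>j \<noteq> 0\<close> \<open>j < n - 1\<close> by linarith
    moreover have "(m + 2) mod 3 \<noteq> 1" if "m mod 3 = 1" for m :: nat using that by presburger
    ultimately show False using r by metis
  qed
  have "Suc (n - 1 - j) = n" using \<open>j = 0\<close> \<open>j < n - 1\<close> by linarith
  then have n3: "n mod 3 = 2" using r mod_Suc[of "n - 1 - j" 3] by simp
  have "p 0 \<noteq> p 2" using adj_1[of 2] not_adj_3[of 0] by auto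
  then have "n \<noteq> 2" using j \<open>j = 0\<close> by metis
  then have "n \<ge> 5" using n3 by presburger
  with that inj j \<open>j = 0\<close> n3 show ?thesis by blast
qed

lemma outside_adj:
  assumes v: "v \<notin> p ` {..n}" and "i \<le> n + 1"
  shows "E (p i) v \<longleftrightarrow> E (p (i mod 3)) v"
  using assms(2)
proof (induction i rule: less_induct)
  case (less i)
  show ?case
  proof (cases "i < 3")
    case False
    then obtain l where l: "i = l + 3" by (metis add.commute le_Suc_ex not_less)
    have "v \<noteq> p (l + 2)" "v \<noteq> p (l + 1)" using v l less.prems by auto
    then have "E (p i) v \<longleftrightarrow> E (p l) v" using adj_add_3[of l v] l by simp
    then show ?thesis using less.IH[of l] l less.prems by simp
  qed simp
qed

text \<open>Adjacency of \<open>p i\<close> to an outside vertex depends only on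
  \<open>i mod 3\<close>. As \<open>p n = p 0\<close>, classes 0 and 2 agree, and the edge between
  \<open>p 3\<close> and \<open>p 2\<close> rules out both. So \<open>p (n + 1)\<close>, of class 0,
  has neighbours only inside the sequence; they lie in \<open>nbh (p 1)\<close>, which settles class
  1.\<close>

lemma outside_not_adjacent:
  assumes inj: "inj_on p {..<n}" and n: "p n = p 0" "n mod 3 = 2" "n \<ge> 5"
    and v: "v \<notin> p ` {..<n}" and "i < n"
  shows "\<not> E (p i) v"
proof -
  have "{..n} = insert n {..<n}" by auto
  moreover have "p 0 \<in> p ` {..<n}" using n(3) by (intro imageI) simp
  ultimately have "p ` {..n} = p ` {..<n}" using n(1) by (simp add: insert_absorb)
  then have period: "E (p i) u \<longleftrightarrow> E (p (i mod 3)) u" if "u \<notin> p ` {..<n}" "i \<le> n + 1" for i u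
    using outside_adj[of u n i] that by simp
  have not0: "\<not> E (p 0) u" and not2: "\<not> E (p 2) u" if u: "u \<notin> p ` {..<n}" for u
  proof -
    have eq: "E (p 0) u \<longleftrightarrow> E (p 2) u" using period[OF u, of n] n by simp
    moreover have "E (p 3) u \<longleftrightarrow> E (p 0) u" using period[OF u, of 3] n by simp
    moreover have "E (p 3) (p 2)" using adj_1[of 2] by simp
    ultimately show "\<not> E (p 0) u" "\<not> E (p 2) u" using no_triangle by blast+
  qed
  have "nbh (p (n + 1)) \<subseteq> nbh (p 1)"
  proof
    fix u assume "u \<in> nbh (p (n + 1))"
    then have u: "E (p (n + 1)) u" by simp
    have "(n + 1) mod 3 = 0" using n by presburger
    then have "u \<in> p ` {..<n}" using period[of u "n + 1"] not0 u by auto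
    then obtain i where i: "i < n" "u = p i" by auto
    have "E (p 1) (p i)"
    proof (cases "i = 0")
      case True
      then show ?thesis using adj_1[of 0] by simp
    next
      case False
      \<comment> \<open>The neighbourhood of \<open>p (n + 1)\<close> arises from that of
        \<open>p (n - 2)\<close> by exchanging \<open>p (n - 1)\<close> for
        \<open>p n = p 0\<close>.\<close>
      have "p i \<noteq> p n" using False i n inj_onD[OF inj, of i 0] by auto
      moreover have shift: "n - 2 + 3 = n + 1" "n - 2 + 2 = n" "n - 2 + 1 = n - 1"
        using n(3) by linarith+
      ultimately have *: "E (p (n - 2)) (p i)" "p i \<noteq> p (n - 1)"
        using adj_add_3[of "n - 2" "p i", unfolded shift] u[unfolded i(2)] by blast+
      have "i \<noteq> n - 1" using * by blast
      moreover have "i \<noteq> n - 2" using * irrefl by blast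
      ultimately have "i < n - 2" using i by linarith
      then have "(n - 2 - i) mod 3 = 1" using adj_iff_less[OF inj, of i "n - 2"] * n by simp
      moreover have "n = (n - 2 - i) + i + 2" using \<open>i < n - 2\<close> by linarith
      moreover have "i mod 3 = 2" if "(m + i + 2) mod 3 = 2" "m mod 3 = 1" for m
        using that by presburger
      ultimately have r: "i mod 3 = 2" using n(2) by metis
      obtain q where "i = 3 * q + 2" using r mult_div_mod_eq[of 3 i] by metis
      then have "1 < i" "(i - 1) mod 3 = 1" by simp_all
      then show ?thesis using adj_iff_less[OF inj, of 1 i] i sym by simp
    qed
    then show "u \<in> nbh (p 1)" using i by simp
  qed
  then have "nbh (p (n + 1)) = nbh (p 1)" using nbh_subset_eq p_in by blast
  then have "E (p 1) v \<longleftrightarrow> E (p (n + 1)) v" by (metis mem_nbh)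
  moreover have "(n + 1) mod 3 = 0" using n by presburger
  ultimately have "\<not> E (p 1) v" using period[OF v, of "n + 1"] not0[OF v] by simp
  moreover have "i mod 3 = 0 \<or> i mod 3 = 1 \<or> i mod 3 = 2" by presburger
  ultimately show ?thesis
    using period[OF v, of i] not0[OF v] not2[OF v] \<open>i < n\<close> by auto
qed

text \<open>An outside vertex would share a neighbour with \<open>p 0\<close>, and one of the two
  edges would join the inside to the outside.\<close>

lemma enumerates_V:
  assumes inj: "inj_on p {..<n}" and n: "p n = p 0" "n mod 3 = 2" "n \<ge> 5"
  shows "p ` {..<n} = V"
proof (rule ccontr)
  assume "p ` {..<n} \<noteq> V"
  then obtain v where v: "v \<in> V" "v \<notin> p ` {..<n}" using p_in by blast
  have not: "\<not> E (p i) u" if "u \<notin> p ` {..<n}" "i < n" for u i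
    using outside_not_adjacent[OF assms that] .
  obtain q where q: "E q v" "E q (p 0)"
  proof -
    have "\<not> E v (p 0)" using not[of v 0] v(2) n(3) sym by auto
    then show ?thesis
      using triple_common_neighbour[of v "p 0" "p 0"] v(1) p_in irrefl that by blast
  qed
  show False
  proof (cases "q \<in> p ` {..<n}")
    case True
    then show False using q(1) not v(2) by auto
  next
    case False
    then show False using q(2) not[of q 0] n sym by auto
  qed
qed

end

context reduced_pach_graph
begin

lemma andrasfai_enumeration:
  obtains p :: "nat \<Rightarrow> 'a" and n where "inj_on p {..<n}" "p ` {..<n} = V" "n mod 3 = 2"
    and "\<And>i j. i < j \<Longrightarrow> j < n \<Longrightarrow> E (p j) (p i) \<longleftrightarrow> (j - i) mod 3 = 1"
proof (cases "\<exists>x\<in>V. \<exists>u\<in>V. u \<noteq> x \<and> \<not> E x u")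
  case True
  then obtain x y w u where "swap x y w u" using swap_exists by blast
  then obtain p :: "nat \<Rightarrow> 'a" where "\<And>i. swap (p i) (p (i + 1)) (p (i + 2)) (p (i + 3))"
    using swap_sequence_exists by blast
  then interpret swap_sequence V E p by unfold_locales
  obtain n where n: "inj_on p {..<n}" "p n = p 0" "n mod 3 = 2" "n \<ge> 5"
    by (rule first_return)
  show ?thesis
    using that[OF n(1) enumerates_V[OF n] n(3)] adj_iff_less[OF n(1)] by simp
next
  case False
  \<comment> \<open>All distinct vertices are adjacent here, so the graph is a single edge, which is
    \<open>\<Gamma>\<^sub>1\<close>.\<close>
  obtain x where x: "x \<in> V" using nonempty by blast
  then obtain y where y: "E y x" using triple_common_neighbour[of x x x] irrefl by blast
  have "v = x \<or> v = y" if "v \<in> V" for v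
    using False x y that edge_in no_triangle sym by metis
  then have "V = {x, y}" using x y edge_in by auto
  moreover have "x \<noteq> y" using y irrefl by blast
  moreover have "{..<2::nat} = {0, 1}" by auto
  ultimately show ?thesis
    using y by (intro that[of "\<lambda>i. if i = 0 then x else y" 2]) (auto simp: less_2_cases_iff)
qed

end

section \<open>The circulant representation and the identification of twins\<close>

lemma andrasfai_adj_multiples:
  assumes "j < i" "i < 3 * k - 1"
  shows "andrasfai_adj k (k * i mod (3 * k - 1)) (k * j mod (3 * k - 1)) \<longleftrightarrow> (i - j) mod 3 = 1"
    and "andrasfai_adj k (k * j mod (3 * k - 1)) (k * i mod (3 * k - 1)) \<longleftrightarrow> (i - j) mod 3 = 1"
proof -
  let ?n = "3 * int k - 1"
  define q r where "q = int ((i - j) div 3)" and "r = int ((i - j) mod 3)"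
  have k: "k \<ge> 1" using assms by auto
  have d: "int i - int j = 3 * q + r"
  proof -
    have "int i - int j = int (3 * ((i - j) div 3) + (i - j) mod 3)"
      using assms(1) by (simp add: of_nat_diff)
    then show ?thesis
      by (simp only: q_def r_def of_nat_add of_nat_mult of_nat_numeral)
  qed
  have qr: "0 \<le> q" "0 \<le> r" "r < 3" unfolding q_def r_def by auto
  have bound: "3 * q + r < ?n" "0 < 3 * q + r" using d assms by linarith+
  have n: "int (3 * k - 1) = ?n" using k by simp
  have m: "int (k * l mod (3 * k - 1)) = (int k * int l) mod ?n" for l
    by (simp only: zmod_int of_nat_mult n)
  have rcases: "r = 0 \<or> r = 1 \<or> r = 2" using qr by auto
  \<comment> \<open>Modulo \<open>3 * k - 1\<close> the number \<open>3 * k\<close> is 1, so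
    \<open>k * (3 * q + r)\<close> reduces to \<open>q + k * r\<close>. As \<open>q < k\<close>,
    this lies in the middle third exactly for \<open>r = 1\<close>.\<close>
  define s where "s = q + int k * r"
  have s: "0 < s" "s < ?n" "s \<in> {int k..2 * int k - 1} \<longleftrightarrow> r = 1"
    using rcases qr bound k unfolding s_def by auto
  have e1: "int k * int i - int k * int j = s + q * ?n"
    using d unfolding s_def by (simp add: algebra_simps flip: right_diff_distrib)
  have "(int k * int i - int k * int j) mod ?n = s"
    unfolding e1 using s by simp
  moreover have "(int k * int j - int k * int i) mod ?n = ?n - s"
  proof -
    have "int k * int j - int k * int i = (?n - s) + (- q - 1) * ?n"
      using e1 by (simp add: algebra_simps)
    also have "\<dots> mod ?n = (?n - s) mod ?n" by (rule mod_mult_self1)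
    also have "\<dots> = ?n - s" using s by (intro mod_pos_pos_trivial) linarith+
    finally show ?thesis .
  qed
  moreover have "?n - s \<in> {int k..2 * int k - 1} \<longleftrightarrow> s \<in> {int k..2 * int k - 1}"
    by auto
  moreover have "(i - j) mod 3 = 1 \<longleftrightarrow> r = 1" unfolding r_def by auto
  moreover have "int (2 * k - 1) = 2 * int k - 1" using k by simp
  ultimately show "andrasfai_adj k (k * i mod (3 * k - 1)) (k * j mod (3 * k - 1)) \<longleftrightarrow> (i - j) mod 3 = 1"
    "andrasfai_adj k (k * j mod (3 * k - 1)) (k * i mod (3 * k - 1)) \<longleftrightarrow> (i - j) mod 3 = 1"
    using s(3) unfolding andrasfai_adj_def m n by (simp_all add: mod_diff_eq)
qed

lemma not_andrasfai_adj_refl: "k \<ge> 1 \<Longrightarrow> \<not> andrasfai_adj k i i"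
  by (simp add: andrasfai_adj_def)

text \<open>The inverse of \<open>k\<close> modulo \<open>3 * k - 1\<close> is 3.\<close>

lemma multiples_surjective:
  fixes k :: nat
  assumes "k \<ge> 1"
  shows "(\<lambda>i. k * i mod (3 * k - 1)) ` {..<3 * k - 1} = {0..<3 * k - 1}"
proof
  show "{0..<3 * k - 1} \<subseteq> (\<lambda>i. k * i mod (3 * k - 1)) ` {..<3 * k - 1}"
  proof
    fix t assume t: "t \<in> {0..<3 * k - 1}"
    have "k * (3 * t mod (3 * k - 1)) mod (3 * k - 1) = k * (3 * t) mod (3 * k - 1)"
      by (simp add: mod_mult_right_eq)
    also have "k * (3 * t) = t + t * (3 * k - 1)"
      using assms by (simp add: algebra_simps)
    also have "\<dots> mod (3 * k - 1) = t" using t by simp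
    finally show "t \<in> (\<lambda>i. k * i mod (3 * k - 1)) ` {..<3 * k - 1}"
      using t by (intro image_eqI[of _ _ "3 * t mod (3 * k - 1)"]) auto
  qed
qed (use assms in auto)

lemma (in reduced_pach_graph) andrasfai_isomorphism:
  "\<exists>k\<ge>1. blowup_of V E {0..<3 * k - 1} (andrasfai_adj k)"
proof -
  obtain p :: "nat \<Rightarrow> 'a" and n where inj: "inj_on p {..<n}" and V: "p ` {..<n} = V" and n: "n mod 3 = 2"
    and adj: "\<And>i j. i < j \<Longrightarrow> j < n \<Longrightarrow> E (p j) (p i) \<longleftrightarrow> (j - i) mod 3 = 1"
    using andrasfai_enumeration by blast
  define k where "k = n div 3 + 1"
  have k: "k \<ge> 1" "n = 3 * k - 1" using n unfolding k_def by presburger+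
  define \<phi> where "\<phi> = (\<lambda>v. k * the_inv_into {..<n} p v mod n)"
  have \<phi>: "\<phi> (p i) = k * i mod n" if "i < n" for i
    unfolding \<phi>_def using the_inv_into_f_f[OF inj] that by simp
  have "\<phi> ` V = (\<lambda>i. k * i mod n) ` {..<n}"
    unfolding V[symmetric] image_image using \<phi> by (intro image_cong) auto
  then have "\<phi> ` V = {0..<n}" using multiples_surjective k by simp
  moreover have "E u v \<longleftrightarrow> andrasfai_adj k (\<phi> u) (\<phi> v)" if uv: "u \<in> V" "v \<in> V" for u v
  proof -
    obtain i j where ij: "i < n" "u = p i" "j < n" "v = p j"
      using uv unfolding V[symmetric] by blast
    show ?thesis
    proof (cases i j rule: linorder_cases)
      case less
      then show ?thesis
        using adj[of i j] andrasfai_adj_multiples(2)[of i j k] ij \<phi> sym_iff[of u v] k by simp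
    next
      case equal
      then show ?thesis using ij irrefl not_andrasfai_adj_refl k by simp
    next
      case greater
      then show ?thesis
        using adj[of j i] andrasfai_adj_multiples(1)[of j i k] ij \<phi> k by simp
    qed
  qed
  ultimately show ?thesis using k unfolding blowup_of_def by blast
qed

text \<open>Choosing one representative \<open>r v\<close> per neighbourhood leaves a twin-free
  graph of the same class; its isomorphism composed with \<open>r\<close> is the blow-up
  map.\<close>

lemma (in pach_graph) blowup_of_andrasfai:
  "\<exists>k\<ge>1. blowup_of V E {0..<3 * k - 1} (andrasfai_adj k)"
proof -
  define r where "r v = (SOME u. u \<in> V \<and> nbh u = nbh v)" for v
  have "r v \<in> V \<and> nbh (r v) = nbh v" if "v \<in> V" for v
    unfolding r_def using someI[of "\<lambda>u. u \<in> V \<and> nbh u = nbh v" v] that by blast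
  then have rV: "r v \<in> V" and nbh_r: "nbh (r v) = nbh v" if "v \<in> V" for v
    using that by auto
  have r_eq: "r u = r v" if "nbh u = nbh v" for u v
    unfolding r_def using that by simp
  have E_r: "E (r u) v \<longleftrightarrow> E u v" if "u \<in> V" for u v
    using nbh_r[OF that] by (metis mem_nbh)
  have E_rr: "E (r u) (r v) \<longleftrightarrow> E u v" if "u \<in> V" "v \<in> V" for u v
    using E_r that sym by blast
  let ?R = "r ` V"
  \<comment> \<open>The locale requires edges to lie inside the vertex set, hence the restriction to
    representatives.\<close>
  let ?E = "\<lambda>u v. E u v \<and> u \<in> ?R \<and> v \<in> ?R"
  have RV: "?R \<subseteq> V" using rV by blast
  interpret R: pach_graph ?R ?E
  proof unfold_locales
    fix S assume S: "S \<subseteq> ?R" "\<And>u v. u \<in> S \<Longrightarrow> v \<in> S \<Longrightarrow> \<not> ?E u v"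
    then obtain w where "w \<in> V" "\<forall>s\<in>S. E w s"
      using indep_common_neighbour[of S] RV by blast
    then show "\<exists>w\<in>?R. \<forall>s\<in>S. ?E w s" using E_r S(1) by blast
  next
    fix x1 y2 y3 x2 y1 x3
    assume "?E x1 y2" "?E x1 y3" "?E x2 y1" "?E x2 y3" "?E x3 y1" "?E x3 y2"
    then show "?E x1 y1 \<or> ?E x2 y2 \<or> ?E x3 y3"
      using no_hexagon[of x1 y2 y3 x2 y1 x3] by blast
  qed (use finite_V nonempty sym no_triangle in blast)+
  interpret R: reduced_pach_graph ?R ?E
  proof unfold_locales
    fix u v assume uv: "u \<in> ?R" "v \<in> ?R" "R.nbh u = R.nbh v"
    have "E u w \<longleftrightarrow> E v w" if "w \<in> V" for w
    proof -
      have "E u (r w) \<longleftrightarrow> E v (r w)"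
        using uv that R.mem_nbh[of "r w" u] R.mem_nbh[of "r w" v] by auto
      then show ?thesis using E_r[OF that] sym by blast
    qed
    then have "nbh u = nbh v" using edge_in unfolding nbh_def by blast
    moreover obtain u' v' where "u = r u'" "v = r v'" "u' \<in> V" "v' \<in> V" using uv by blast
    ultimately show "u = v" using r_eq[of u' v'] nbh_r[of u'] nbh_r[of v'] by simp
  qed
  obtain k where k: "k \<ge> 1" and "blowup_of ?R ?E {0..<3 * k - 1} (andrasfai_adj k)"
    using R.andrasfai_isomorphism by blast
  then obtain \<phi> where \<phi>: "\<phi> ` ?R = {0..<3 * k - 1}"
    and adj: "\<forall>u\<in>?R. \<forall>v\<in>?R. ?E u v \<longleftrightarrow> andrasfai_adj k (\<phi> u) (\<phi> v)"
    unfolding blowup_of_def by (elim exE conjE)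
  have "(\<phi> \<circ> r) ` V = {0..<3 * k - 1}" using \<phi> by (simp add: image_comp)
  moreover have "E u v \<longleftrightarrow> andrasfai_adj k ((\<phi> \<circ> r) u) ((\<phi> \<circ> r) v)" if "u \<in> V" "v \<in> V" for u v
    using adj E_rr[OF that] that by auto
  ultimately show ?thesis using k unfolding blowup_of_def by blast
qed

theorem theorem1p3:
  fixes V :: "'a set" and E :: "'a \<Rightarrow> 'a \<Rightarrow> bool"
  assumes "graph V E" and "V \<noteq> {}"
    and "maximal_triangle_free V E"
    and "\<not> contains_upsilon V E"
    and "property_D 3 V E"
  shows "\<exists>k\<ge>1. blowup_of V E {0..<3*k - 1} (andrasfai_adj k)"
proof -
  have g: "finite V" "\<And>u v. E u v \<Longrightarrow> u \<in> V \<and> v \<in> V" "\<And>u v. E u v \<Longrightarrow> E v u" "\<And>u. \<not> E u u"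
    using assms(1) unfolding graph_def by blast+
  have tf: "\<And>x y z. E x y \<Longrightarrow> E y z \<Longrightarrow> \<not> E x z"
    using assms(3) g(2) unfolding maximal_triangle_free_def triangle_free_def by blast
  interpret triangle_free_graph V E
    using g tf by unfold_locales
  have "\<exists>w. E w u \<and> E w v" if uv: "u \<in> V" "v \<in> V" "\<not> E u v" for u v
  proof (cases "u = v")
    case True
    \<comment> \<open>Maximality concerns distinct vertices only; \<open>\<D>\<^sub>1\<close> for
      the constant sequence gives \<open>u\<close> a neighbour.\<close>
    then show ?thesis
      using property_D_list[OF assms(5), of 1 "[u, u, u]"] uv by (auto split: if_splits)
  next
    case False
    then show ?thesis
      using assms(3) uv sym unfolding maximal_triangle_free_def by blast
  qed
  then interpret upsilon_free_graph V E
    using assms(4) by unfold_locales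
  note triple = independent_triple_common_neighbour[OF assms(5)]
  interpret pach_graph V E
  proof unfold_locales
    show "E x1 y1 \<or> E x2 y2 \<or> E x3 y3"
      if "E x1 y2" "E x1 y3" "E x2 y1" "E x2 y3" "E x3 y1" "E x3 y2" for x1 y2 y3 x2 y1 x3
      using no_induced_hexagon[OF triple that] by blast
  qed (use assms(2) independent_common_neighbour[OF assms(5,2)] in blast)+
  show ?thesis by (rule blowup_of_andrasfai)
qed

end
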